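(* Let $1\le q<p$ and $n<p$. Let $\mathbf X\in\mathbb R^{p\times n}$ be partitioned by rows as $\mathbf X=\begin{bmatrix}\mathbf X_0\\ \mathbf X'\end{bmatrix}$ with $\mathbf X_0\in\mathbb R^{(p-q)\times n}$ of full column rank $n$ and $\mathbf X'\in\mathbb R^{q\times n}$, and let $\mathbf y_0\in\mathbb R^{p-q}$. Let $\mathbf A\in\{0,1\}^{n\times K}$ be a source-membership matrix: each row of $\mathbf A$ has exactly one entry equal to $1$ (the others being $0$), and each column of $\mathbf A$ contains at least one $1$. Put $\mathbf P_{\mathbf A}=\mathbf A(\mathbf A^\top\mathbf A)^{-1}\mathbf A^\top$, $\hat{\mathbf M}=\mathbf X\mathbf A(\mathbf A^\top\mathbf A)^{-1}$, and for $\gamma>0$ let $\hat\Sigma_\gamma$ be a positive scalar multiple of $\mathbf X(\mathbf I_n-\mathbf P_{\mathbf A})\mathbf X^\top+\gamma\mathbf I_p$. Partition these conformably with the rows of $\mathbf X$: $$\hat{\mathbf M}=\begin{bmatrix}\hat{\mathbf M}_0\\ \hat{\mathbf M}'\end{bmatrix},\qquad \hat\Sigma_\gamma=\begin{bmatrix}\hat\Sigma_{0\gamma}&\hat\Delta\\ \hat\Delta^\top&\hat\Sigma'_\gamma\end{bmatrix},$$ where $\hat{\mathbf M}_0$ is $(p-q)\times K$, $\hat{\mathbf M}'$ is $q\times K$, $\hat\Sigma_{0\gamma}$ is $(p-q)\times(p-q)$, $\hat\Delta$ is $(p-q)\times q$ and $\hat\Sigma'_\gamma$ is $q\times q$. Define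 $$\hat{\boldsymbol\theta}_{0\gamma}=(\hat{\mathbf M}_0^\top\hat\Sigma_{0\gamma}^{-1}\hat{\mathbf M}_0)^{-1}\hat{\mathbf M}_0^\top\hat\Sigma_{0\gamma}^{-1}\mathbf y_0,\qquad \hat{\mathbf y}'_\gamma=\hat{\mathbf M}'\hat{\boldsymbol\theta}_{0\gamma}+\hat\Delta^\top\hat\Sigma_{0\gamma}^{-1}(\mathbf y_0-\hat{\mathbf M}_0\hat{\boldsymbol\theta}_{0\gamma}).$$ Then $$\lim_{\gamma\to0}\hat{\mathbf y}'_\gamma=\mathbf X'(\mathbf X_0^\top\mathbf X_0)^{-1}\mathbf X_0^\top\mathbf y_0\qquad\text{and}\qquad\lim_{\gamma\to\infty}\hat{\mathbf y}'_\gamma=\hat{\mathbf M}'(\hat{\mathbf M}_0^\top\hat{\mathbf M}_0)^{-1}\hat{\mathbf M}_0^\top\mathbf y_0 .$$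
   Context: The columns of $\mathbf X$ are $n$ dictionary profiles, each belonging to exactly one of $K$ source categories; $A_{ik}=1$ if profile $i$ belongs to category $k$ and $A_{ik}=0$ otherwise. The vector $\mathbf y_0$ is the observed part of a $p$-dimensional profile and $\hat{\mathbf y}'_\gamma$ is a predictor of its unobserved $q$-dimensional part. The limit $\gamma\to0$ is through positive values of $\gamma$. *)

theory Defs
  imports "HOL-Analysis.Analysis"
begin

text \<open>
  The \<open>p\<close> rows of a profile matrix are indexed by \<open>'m + 'q\<close>: \<open>Inl\<close> gives the \<open>p - q\<close> observed
  rows and \<open>Inr\<close> the \<open>q\<close> unobserved ones.
\<close>

definition obs_rows :: "real^'n^('m::finite + 'q::finite) \<Rightarrow> real^'n^'m" where
  "obs_rows M = (\<chi> i. M $ Inl i)"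

definition unobs_rows :: "real^'n^('m::finite + 'q::finite) \<Rightarrow> real^'n^'q" where
  "unobs_rows M = (\<chi> i. M $ Inr i)"

definition obs_block ::
    "real^('m::finite + 'q::finite)^('m + 'q) \<Rightarrow> real^'m^'m" where
  "obs_block S = (\<chi> i j. S $ Inl i $ Inl j)"

definition cross_block ::
    "real^('m::finite + 'q::finite)^('m + 'q) \<Rightarrow> real^'q^'m" where
  "cross_block S = (\<chi> i j. S $ Inl i $ Inr j)"

definition source_membership :: "real^'k^'n \<Rightarrow> bool" where
  "source_membership A \<longleftrightarrow>
     (\<forall>i k. A $ i $ k \<in> {0, 1}) \<and>
     (\<forall>i. \<exists>!k. A $ i $ k = 1) \<and>
     (\<forall>k. \<exists>i. A $ i $ k = 1)"

definition membership_proj :: "real^'k^'n \<Rightarrow> real^'n^'n" where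
  "membership_proj A = A ** matrix_inv (transpose A ** A) ** transpose A"

definition category_means :: "real^'n^'p \<Rightarrow> real^'k^'n \<Rightarrow> real^'k^'p" where
  "category_means X A = X ** A ** matrix_inv (transpose A ** A)"

definition ridge_scatter :: "real^'n^'p \<Rightarrow> real^'k^'n \<Rightarrow> real \<Rightarrow> real^'p^'p" where
  "ridge_scatter X A \<gamma> =
     X ** (mat 1 - membership_proj A) ** transpose X + \<gamma> *\<^sub>R mat 1"

definition gls_coeff :: "real^'k^'m \<Rightarrow> real^'m^'m \<Rightarrow> real^'m \<Rightarrow> real^'k" where
  "gls_coeff M\<^sub>0 S\<^sub>0 y\<^sub>0 =
     (matrix_inv (transpose M\<^sub>0 ** matrix_inv S\<^sub>0 ** M\<^sub>0)
        ** transpose M\<^sub>0 ** matrix_inv S\<^sub>0) *v y\<^sub>0"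

definition profile_predictor ::
    "real^'k^('m::finite + 'q::finite) \<Rightarrow> real^('m + 'q)^('m + 'q) \<Rightarrow> real^'m \<Rightarrow> real^'q" where
  "profile_predictor M S y\<^sub>0 =
     (let M\<^sub>0 = obs_rows M;
          \<theta> = gls_coeff M\<^sub>0 (obs_block S) y\<^sub>0
      in unobs_rows M *v \<theta>
         + (transpose (cross_block S) ** matrix_inv (obs_block S)) *v (y\<^sub>0 - M\<^sub>0 *v \<theta>))"

end

theory Submission
  imports Defs
begin

text \<open>
  Put \<open>Q = I - P\<^sub>A\<close>. The prediction equals \<open>X' w\<close>, where \<open>w\<close> minimises the partially
  penalised least-squares functional \<open>|y\<^sub>0 - X\<^sub>0 w|\<^sup>2 + \<gamma> |Q w|\<^sup>2\<close>, that is,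
  \<open>(X\<^sub>0\<^sup>T X\<^sub>0 + \<gamma> Q) w = X\<^sub>0\<^sup>T y\<^sub>0\<close>. Pairing this equation with \<open>w\<close> gives
  \<open>\<gamma> |Q w|\<^sup>2 \<le> |y\<^sub>0|\<^sup>2\<close>. Hence \<open>\<gamma> Q w \<rightarrow> 0\<close> as \<open>\<gamma> \<rightarrow> 0\<close>, which leaves ordinary least squares
  over all of \<open>\<real>\<^sup>n\<close>, and \<open>Q w \<rightarrow> 0\<close> as \<open>\<gamma> \<rightarrow> \<infinity>\<close>, which leaves least squares over the range
  of \<open>A\<close>, because \<open>A\<^sup>T\<close> annihilates the penalty term.
\<close>

declare transpose_matrix_vector [simp del]

section \<open>Positive definite matrices, their inverses and weighted least squares\<close>

lemma invertible_if_pos_def: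
  fixes S :: "real^'a^'a"
  assumes "\<And>x. x \<noteq> 0 \<Longrightarrow> x \<bullet> (S *v x) > 0"
  shows "invertible S"
proof -
  have "x = 0" if "S *v x = 0" for x
    using assms[of x] that by force
  then show ?thesis
    by (simp add: invertible_left_inverse matrix_left_invertible_ker)
qed

lemma inner_transpose_mult: "x \<bullet> (transpose B *v y) = (B *v x) \<bullet> y" for B :: "real^'a^'b"
  by (metis dot_lmul_matrix inner_commute transpose_matrix_vector)

lemma invertible_gram:
  fixes B :: "real^'a^'b"
  assumes "inj ((*v) B)"
  shows "invertible (transpose B ** B)"
proof (rule invertible_if_pos_def)
  fix x :: "real^'a" assume "x \<noteq> 0"
  then have "B *v x \<noteq> 0"
    using assms by (metis injD matrix_vector_mult_0_right)
  then show "x \<bullet> ((transpose B ** B) *v x) > 0"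
    by (simp flip: matrix_vector_mul_assoc add: inner_transpose_mult)
qed

lemma matrix_inv_cancel:
  fixes S :: "real^'a^'a"
  assumes "invertible S"
  shows "S ** matrix_inv S = mat 1" "matrix_inv S ** S = mat 1"
  using someI_ex[OF assms[unfolded invertible_def]] unfolding matrix_inv_def by auto

lemma matrix_inv_mult_vec:
  fixes S :: "real^'a^'a"
  assumes "invertible S"
  shows "S *v (matrix_inv S *v x) = x" "matrix_inv S *v (S *v x) = x"
  using matrix_inv_cancel[OF assms] by (simp_all add: matrix_vector_mul_assoc)

text \<open>Substituting \<open>x = S *v z\<close> turns the quadratic form of the inverse at
  \<open>x\<close> into that of \<open>S\<close> at \<open>z\<close>.\<close>

lemma pos_def_matrix_inv:
  fixes S :: "real^'a^'a"
  assumes pos: "\<And>x. x \<noteq> 0 \<Longrightarrow> x \<bullet> (S *v x) > 0" and "x \<noteq> 0"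
  shows "x \<bullet> (matrix_inv S *v x) > 0"
proof -
  note inv = matrix_inv_mult_vec[OF invertible_if_pos_def[OF pos]]
  have "matrix_inv S *v x \<noteq> 0"
    using inv(1)[of x] \<open>x \<noteq> 0\<close> by auto
  from pos[OF this] show ?thesis
    by (simp add: inv inner_commute)
qed

lemma matrix_inv_symmetric:
  fixes S :: "real^'a^'a"
  assumes "invertible S" "transpose S = S"
  shows "transpose (matrix_inv S) = matrix_inv S"
proof -
  have "transpose (matrix_inv S) ** S = mat 1"
    using matrix_inv_cancel(1)[OF assms(1)] assms(2) by (metis matrix_transpose_mul transpose_mat)
  then have "transpose (matrix_inv S) ** (S ** matrix_inv S) = matrix_inv S"
    by (simp add: matrix_mul_assoc)
  then show ?thesis
    by (simp add: matrix_inv_cancel(1)[OF assms(1)])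
qed

text \<open>The Gram matrix of \<open>B\<close> weighted by the inverse of \<open>S\<close> is
  positive definite, hence invertible, so \<open>gls_coeff\<close> really solves its linear system.
  This orthogonality is the only property of \<open>gls_coeff\<close> used later.\<close>

lemma gls_normal_equation:
  fixes B :: "real^'k^'m" and S :: "real^'m^'m"
  assumes "inj ((*v) B)" and pos: "\<And>x. x \<noteq> 0 \<Longrightarrow> x \<bullet> (S *v x) > 0"
  shows "transpose B *v (matrix_inv S *v (y - B *v gls_coeff B S y)) = 0"
proof -
  let ?N = "transpose B ** matrix_inv S ** B"
  have "invertible ?N"
  proof (rule invertible_if_pos_def)
    fix x :: "real^'k" assume "x \<noteq> 0"
    then have "B *v x \<noteq> 0"
      using assms(1) by (metis injD matrix_vector_mult_0_right)
    with pos_def_matrix_inv[OF pos] show "x \<bullet> (?N *v x) > 0"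
      by (simp flip: matrix_vector_mul_assoc add: inner_transpose_mult)
  qed
  then have "?N *v gls_coeff B S y = transpose B *v (matrix_inv S *v y)"
    unfolding gls_coeff_def
    by (simp add: matrix_vector_mul_assoc matrix_mul_assoc matrix_inv_cancel)
  then show ?thesis
    by (simp add: matrix_vector_mult_diff_distrib flip: matrix_vector_mul_assoc)
qed

section \<open>The membership matrix and its projection\<close>

lemma inj_source_membership:
  assumes "source_membership A"
  shows "inj ((*v) A)"
proof (rule injI)
  fix x y assume eq: "A *v x = A *v y"
  show "x = y"
  proof (rule vec_eq_iff[THEN iffD2], rule allI)
    fix k
    \<comment> \<open>Any profile \<open>i\<close> of category \<open>k\<close> serves: its row of
      \<open>A\<close> is the \<open>k\<close>-th unit vector, so entry \<open>i\<close> of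
      \<open>A *v z\<close> reads off \<open>z $ k\<close>.\<close>
    obtain i where i: "A $ i $ k = 1"
      using assms unfolding source_membership_def by blast
    have A: "A $ i $ l = (if l = k then 1 else 0)" for l
      using assms i unfolding source_membership_def by (metis empty_iff insertE)
    have "(A *v z) $ i = z $ k" for z
      by (simp add: matrix_vector_mult_def A if_distrib[of "\<lambda>t. t * _"] cong: if_cong)
    then show "x $ k = y $ k"
      using eq by metis
  qed
qed

lemma transpose_membership_proj:
  assumes "invertible (transpose A ** A)"
  shows "transpose (membership_proj A) = membership_proj A"
  using matrix_inv_symmetric[OF assms]
  by (simp add: membership_proj_def matrix_transpose_mul matrix_mul_assoc)

lemma transpose_mult_membership_proj:
  assumes "invertible (transpose A ** A)"
  shows "transpose A ** membership_proj A = transpose A"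
  using matrix_inv_cancel(1)[OF assms]
  by (simp add: membership_proj_def matrix_mul_assoc)

section \<open>Row blocks of the mean and scatter matrices\<close>

lemma obs_rows_mult: "obs_rows (X ** B) = obs_rows X ** B"
  by (simp add: obs_rows_def matrix_matrix_mult_def vec_eq_iff)

lemma unobs_rows_mult: "unobs_rows (X ** B) = unobs_rows X ** B"
  by (simp add: unobs_rows_def matrix_matrix_mult_def vec_eq_iff)

lemma obs_block_ridge:
  "obs_block (c *\<^sub>R (X ** Q ** transpose X + \<gamma> *\<^sub>R mat 1)) =
     c *\<^sub>R (obs_rows X ** Q ** transpose (obs_rows X) + \<gamma> *\<^sub>R mat 1)"
  by (simp add: obs_block_def obs_rows_def matrix_matrix_mult_def vec_eq_iff transpose_def mat_def)

lemma cross_block_ridge: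
  "cross_block (c *\<^sub>R (X ** Q ** transpose X + \<gamma> *\<^sub>R mat 1)) =
     c *\<^sub>R (obs_rows X ** Q ** transpose (unobs_rows X))"
  by (simp add: cross_block_def obs_rows_def unobs_rows_def matrix_matrix_mult_def vec_eq_iff
      transpose_def mat_def)

section \<open>The complementary projection and the reduction to penalised least squares\<close>

lemma transpose_diff: "transpose (B - C) = transpose B - transpose C" for B C :: "real^'a^'b"
  by (simp add: transpose_def vec_eq_iff)

lemma matrix_diff_ldistrib: "B ** (C - D) = B ** C - B ** D" for B :: "real^'a^'b"
  by (simp add: matrix_matrix_mult_def vec_eq_iff algebra_simps sum_subtractf)

text \<open>\<open>Q\<close> is the orthogonal projection onto the kernel of
  \<open>transpose A\<close>. Idempotence comes from \<open>Q ** A = 0\<close>, since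
  \<open>membership_proj A\<close> has \<open>A\<close> as its left factor.\<close>

lemma residual_proj:
  fixes A :: "real^'k^'n"
  defines "Q \<equiv> mat 1 - membership_proj A"
  assumes "invertible (transpose A ** A)"
  shows "transpose Q = Q" "transpose A ** Q = 0" "Q ** A = 0" "Q ** Q = Q"
proof -
  show sym: "transpose Q = Q"
    by (simp add: Q_def transpose_diff transpose_membership_proj assms(2))
  show AQ: "transpose A ** Q = 0"
    by (simp add: Q_def matrix_diff_ldistrib transpose_mult_membership_proj assms(2))
  show QA: "Q ** A = 0"
    using arg_cong[OF AQ, of transpose]
    by (simp add: matrix_transpose_mul sym) (simp add: transpose_def vec_eq_iff)
  show "Q ** Q = Q"
    by (subst (2) Q_def) (simp add: matrix_diff_ldistrib membership_proj_def matrix_mul_assoc QA)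
qed

lemma inner_residual:
  fixes Q :: "real^'n^'n"
  assumes "transpose Q = Q" "Q ** Q = Q"
  shows "x \<bullet> (Q *v x) = (norm (Q *v x))\<^sup>2"
proof -
  have "x \<bullet> (Q *v x) = x \<bullet> (transpose Q *v (Q *v x))"
    by (simp add: assms matrix_vector_mul_assoc)
  then show ?thesis
    by (simp add: inner_transpose_mult power2_norm_eq_inner)
qed

text \<open>The first summand contributes the squared norm of
  \<open>Q *v (transpose Z *v x)\<close>, which may vanish; the ridge term makes the form strictly
  positive.\<close>

lemma pos_def_ridge:
  fixes Z :: "real^'n^'m" and Q :: "real^'n^'n"
  assumes "transpose Q = Q" "Q ** Q = Q" "\<gamma> > 0" "x \<noteq> 0"
  shows "x \<bullet> ((Z ** Q ** transpose Z + \<gamma> *\<^sub>R mat 1) *v x) > 0"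
proof -
  have "x \<bullet> ((Z ** Q ** transpose Z) *v x) = (transpose Z *v x) \<bullet> (Q *v (transpose Z *v x))"
    using inner_transpose_mult[of x "transpose Z"] by (simp flip: matrix_vector_mul_assoc)
  then have "x \<bullet> ((Z ** Q ** transpose Z) *v x) \<ge> 0"
    by (simp add: inner_residual assms)
  moreover have "\<gamma> * (x \<bullet> x) > 0"
    using assms by simp
  ultimately show ?thesis
    by (simp add: matrix_vector_mult_add_rdistrib inner_add_right flip: scaleR_matrix_vector_assoc)
qed

text \<open>This passes from the dual form of the predictor, which inverts a matrix on the observed
  rows, to a primal equation for weights on the profiles. The scale \<open>c\<close>
  cancels.\<close>

lemma profile_predictor_ridge:
  fixes X :: "real^'n^('m::finite + 'q::finite)" and A :: "real^'k^'n" and y :: "real^'m"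
  defines "Z \<equiv> obs_rows X" and "Q \<equiv> mat 1 - membership_proj A"
  assumes injZ: "inj ((*v) Z)" and mem: "source_membership A" and "\<gamma> > 0" "c > 0"
  obtains w where
    "profile_predictor (category_means X A) (c *\<^sub>R ridge_scatter X A \<gamma>) y = unobs_rows X *v w"
    "transpose Z *v (Z *v w) + \<gamma> *\<^sub>R (Q *v w) = transpose Z *v y"
proof -
  define G where "G = matrix_inv (transpose A ** A)"
  define S where "S = Z ** Q ** transpose Z + \<gamma> *\<^sub>R mat 1"
  define B where "B = Z ** (A ** G)"
  define \<theta> where "\<theta> = gls_coeff B (c *\<^sub>R S) y"
  \<comment> \<open>\<open>b\<close> rewrites the fitted mean as a combination of profiles:
    \<open>B *v \<theta> = Z *v b\<close>. The vector \<open>s\<close> below is the inverse of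
    \<open>S\<close> applied to the residual \<open>r\<close>, and \<open>w\<close> adds to
    \<open>b\<close> the weights by which the covariance term acts on the profiles.\<close>
  define b where "b = A *v (G *v \<theta>)"
  define r where "r = y - Z *v b"
  define s where "s = c *\<^sub>R (matrix_inv (c *\<^sub>R S) *v r)"
  define w where "w = b + Q *v (transpose Z *v s)"
  have invA: "invertible (transpose A ** A)"
    by (intro invertible_gram inj_source_membership mem)
  note G = matrix_inv_cancel[OF invA, folded G_def]
  have symG: "transpose G = G"
    unfolding G_def by (intro matrix_inv_symmetric invA) (simp add: matrix_transpose_mul)
  have P: "membership_proj A = A ** G ** transpose A"
    by (simp add: membership_proj_def G_def)
  note symQ = residual_proj(1)[OF invA, folded Q_def]
    and QA = residual_proj(3)[OF invA, folded Q_def]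
    and QQ = residual_proj(4)[OF invA, folded Q_def]
  have pos: "x \<bullet> ((c *\<^sub>R S) *v x) > 0" if "x \<noteq> 0" for x
    using pos_def_ridge[OF symQ QQ \<open>\<gamma> > 0\<close> that, of Z] \<open>c > 0\<close>
    by (simp add: S_def flip: scaleR_matrix_vector_assoc)
  have injB: "inj ((*v) B)"
  proof (rule injI)
    fix u v assume "B *v u = B *v v"
    then have "A *v (G *v u) = A *v (G *v v)"
      using injZ by (simp add: B_def injD flip: matrix_vector_mul_assoc)
    then have "(transpose A ** A ** G) *v u = (transpose A ** A ** G) *v v"
      by (simp flip: matrix_vector_mul_assoc)
    then show "u = v"
      by (simp add: G)
  qed
  have Bb: "B *v \<theta> = Z *v b"
    by (simp add: B_def b_def flip: matrix_vector_mul_assoc)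
  have "transpose B *v s = 0"
    using gls_normal_equation[OF injB pos, of y]
    by (simp add: s_def r_def Bb matrix_vector_mult_scaleR flip: \<theta>_def)
  \<comment> \<open>\<open>transpose B\<close> is \<open>G ** transpose A ** transpose Z\<close>,
    and \<open>G\<close> is cancelled by multiplying with \<open>transpose A ** A\<close>. Hence
    \<open>Q\<close> fixes \<open>transpose Z *v s\<close>.\<close>
  then have "transpose A *v (transpose Z *v s) = 0"
    using G(1) unfolding B_def matrix_transpose_mul symG
    by (metis matrix_vector_mul_assoc matrix_vector_mul_lid matrix_vector_mult_0_right)
  then have QZ: "Q *v (transpose Z *v s) = transpose Z *v s"
    by (simp add: Q_def P matrix_vector_mult_diff_rdistrib flip: matrix_vector_mul_assoc)
  have Qb: "Q *v b = 0"
    by (simp add: b_def matrix_vector_mul_assoc matrix_mul_assoc QA)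
  have "S *v s = r"
    using matrix_inv_mult_vec(1)[OF invertible_if_pos_def[OF pos]]
    by (simp add: s_def matrix_vector_mult_scaleR flip: scaleR_matrix_vector_assoc)
  \<comment> \<open>Expanding \<open>S *v s = r\<close>, the part of \<open>S\<close> containing
    \<open>Q\<close> is exactly what \<open>w\<close> adds to \<open>b\<close>, so only the ridge
    part remains.\<close>
  then have "y - Z *v w = \<gamma> *\<^sub>R s"
    by (simp add: S_def r_def w_def algebra_simps scaleR_matrix_vector_assoc[symmetric]
        matrix_vector_mul_assoc[symmetric])
  then have "transpose Z *v (y - Z *v w) = \<gamma> *\<^sub>R (transpose Z *v s)"
    by (simp add: matrix_vector_mult_scaleR)
  moreover have "Q *v w = transpose Z *v s"
    by (simp add: w_def matrix_vector_right_distrib Qb QZ)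
  ultimately have "transpose Z *v (Z *v w) + \<gamma> *\<^sub>R (Q *v w) = transpose Z *v y"
    by (simp add: algebra_simps)
  moreover
  have "profile_predictor (category_means X A) (c *\<^sub>R ridge_scatter X A \<gamma>) y = unobs_rows X *v w"
  proof -
    have M: "category_means X A = X ** (A ** G)"
      by (simp add: category_means_def G_def matrix_mul_assoc)
    have "obs_block (c *\<^sub>R ridge_scatter X A \<gamma>) = c *\<^sub>R S"
      by (simp add: ridge_scatter_def obs_block_ridge S_def Z_def Q_def)
    moreover have "transpose (cross_block (c *\<^sub>R ridge_scatter X A \<gamma>))
        = c *\<^sub>R (unobs_rows X ** Q ** transpose Z)"
      by (simp add: ridge_scatter_def cross_block_ridge Z_def transpose_scalar
          matrix_transpose_mul symQ matrix_mul_assoc flip: Q_def)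
    ultimately show ?thesis
      unfolding profile_predictor_def Let_def M obs_rows_mult unobs_rows_mult
      by (simp add: w_def s_def r_def b_def B_def[symmetric] Z_def[symmetric] \<theta>_def[symmetric]
          Bb[unfolded b_def] matrix_vector_right_distrib matrix_vector_mult_scaleR
          scaleR_matrix_vector_assoc[symmetric] matrix_vector_mul_assoc[symmetric])
  qed
  ultimately show ?thesis
    using that by blast
qed

section \<open>The penalty bound and the two limits\<close>

lemma ridge_residual_bound:
  fixes Z :: "real^'n^'m" and Q :: "real^'n^'n"
  assumes "transpose Q = Q" "Q ** Q = Q"
    and eq: "transpose Z *v (Z *v w) + \<gamma> *\<^sub>R (Q *v w) = transpose Z *v y"
  shows "\<gamma> * (norm (Q *v w))\<^sup>2 \<le> (norm y)\<^sup>2"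
proof -
  have "(Z *v w) \<bullet> (Z *v w) + \<gamma> * (w \<bullet> (Q *v w)) = (Z *v w) \<bullet> y"
    using arg_cong[OF eq, of "inner w"] by (simp add: inner_add_right inner_transpose_mult)
  then have "(norm (Z *v w))\<^sup>2 + \<gamma> * (norm (Q *v w))\<^sup>2 \<le> norm (Z *v w) * norm y"
    by (metis inner_residual[OF assms(1,2)] norm_cauchy_schwarz power2_norm_eq_inner)
  moreover have "norm (Z *v w) * norm y \<le> (norm (Z *v w))\<^sup>2 + (norm y)\<^sup>2"
    using sum_squares_bound[of "norm (Z *v w)" "norm y"]
      mult_nonneg_nonneg[OF norm_ge_zero[of "Z *v w"] norm_ge_zero[of y]] by linarith
  ultimately show ?thesis
    by linarith
qed

theorem proposition3:
  fixes X :: "real^'n^('m::finite + 'q::finite)"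
    and A :: "real^'k^'n"
    and \<Sigma> :: "real \<Rightarrow> real^('m + 'q)^('m + 'q)"
    and y\<^sub>0 :: "real^'m"
  defines "X\<^sub>0 \<equiv> obs_rows X" and "X' \<equiv> unobs_rows X"
    and "M \<equiv> category_means X A"
  defines "M\<^sub>0 \<equiv> obs_rows M" and "M' \<equiv> unobs_rows M"
  assumes "CARD('n) < CARD('m + 'q)"
    and "rank X\<^sub>0 = CARD('n)"
    and "source_membership A"
    and "\<And>\<gamma>. \<gamma> > 0 \<Longrightarrow> \<exists>c>0. \<Sigma> \<gamma> = c *\<^sub>R ridge_scatter X A \<gamma>"
  shows "((\<lambda>\<gamma>. profile_predictor M (\<Sigma> \<gamma>) y\<^sub>0) \<longlongrightarrow>
            (X' ** matrix_inv (transpose X\<^sub>0 ** X\<^sub>0) ** transpose X\<^sub>0) *v y\<^sub>0) (at_right 0)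
       \<and> ((\<lambda>\<gamma>. profile_predictor M (\<Sigma> \<gamma>) y\<^sub>0) \<longlongrightarrow>
            (M' ** matrix_inv (transpose M\<^sub>0 ** M\<^sub>0) ** transpose M\<^sub>0) *v y\<^sub>0) at_top"
proof -
  define Q where "Q = mat 1 - membership_proj A"
  define H where "H = A ** matrix_inv (transpose A ** A)"
  define N where "N = matrix_inv (transpose X\<^sub>0 ** X\<^sub>0)"
  define N\<^sub>A where "N\<^sub>A = matrix_inv (transpose M\<^sub>0 ** M\<^sub>0)"
  have injX: "inj ((*v) X\<^sub>0)"
    using assms(7) by (simp add: full_rank_injective)
  have invA: "invertible (transpose A ** A)"
    by (intro invertible_gram inj_source_membership assms)
  note Q = residual_proj[OF invA, folded Q_def]
  note G = matrix_inv_cancel[OF invA]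
  have AH: "transpose A ** H = mat 1"
    by (simp add: H_def G matrix_mul_assoc)
  have HQ: "transpose H ** Q = 0"
    by (simp add: H_def matrix_transpose_mul matrix_mul_assoc[symmetric] Q)
  \<comment> \<open>\<open>H ** transpose A\<close> is \<open>membership_proj A\<close>, so this
    splits \<open>w\<close> into its part in the range of \<open>A\<close> and its penalised
    part.\<close>
  have decomp: "H *v (transpose A *v w) + Q *v w = w" for w
    by (simp add: Q_def membership_proj_def H_def matrix_vector_mult_diff_rdistrib
        matrix_vector_mul_assoc)
  have M\<^sub>0: "M\<^sub>0 = X\<^sub>0 ** H" and M': "M' = X' ** H"
    by (simp_all add: M\<^sub>0_def M'_def M_def category_means_def H_def X\<^sub>0_def X'_def
        obs_rows_mult unobs_rows_mult matrix_mul_assoc)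
  have injM: "inj ((*v) M\<^sub>0)"
  proof (rule injI)
    fix u v assume "M\<^sub>0 *v u = M\<^sub>0 *v v"
    then have "H *v u = H *v v"
      using injX by (simp add: M\<^sub>0 injD flip: matrix_vector_mul_assoc)
    then have "(transpose A ** H) *v u = (transpose A ** H) *v v"
      by (simp flip: matrix_vector_mul_assoc)
    then show "u = v"
      by (simp add: AH)
  qed
  have N: "N *v (transpose X\<^sub>0 *v (X\<^sub>0 *v w)) = w" for w
    using matrix_inv_mult_vec(2)[OF invertible_gram[OF injX]]
    by (simp add: N_def flip: matrix_vector_mul_assoc)
  have N\<^sub>A: "N\<^sub>A *v (transpose M\<^sub>0 *v (M\<^sub>0 *v w)) = w" for w
    using matrix_inv_mult_vec(2)[OF invertible_gram[OF injM]]
    by (simp add: N\<^sub>A_def flip: matrix_vector_mul_assoc)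
  \<comment> \<open>Neither claim about \<open>w\<close> mentions \<open>c\<close>, so the scale of
    \<open>\<Sigma> \<gamma>\<close> may vary arbitrarily with \<gamma>.\<close>
  have "\<exists>w. profile_predictor M (\<Sigma> \<gamma>) y\<^sub>0 = X' *v w \<and>
      transpose X\<^sub>0 *v (X\<^sub>0 *v w) + \<gamma> *\<^sub>R (Q *v w) = transpose X\<^sub>0 *v y\<^sub>0" if "\<gamma> > 0" for \<gamma>
  proof -
    obtain c where c: "c > 0" "\<Sigma> \<gamma> = c *\<^sub>R ridge_scatter X A \<gamma>"
      using assms(9)[OF \<open>\<gamma> > 0\<close>] by blast
    show ?thesis
      using profile_predictor_ridge[OF injX[unfolded X\<^sub>0_def] assms(8) \<open>\<gamma> > 0\<close> c(1), of y\<^sub>0] c(2)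
      unfolding M_def X\<^sub>0_def X'_def Q_def by metis
  qed
  then obtain w where w: "\<And>\<gamma>. \<gamma> > 0 \<Longrightarrow> profile_predictor M (\<Sigma> \<gamma>) y\<^sub>0 = X' *v w \<gamma>"
    and eq: "\<And>\<gamma>. \<gamma> > 0 \<Longrightarrow>
      transpose X\<^sub>0 *v (X\<^sub>0 *v w \<gamma>) + \<gamma> *\<^sub>R (Q *v w \<gamma>) = transpose X\<^sub>0 *v y\<^sub>0"
    by metis
  define e where "e \<gamma> = Q *v w \<gamma>" for \<gamma>
  have e: "norm (e \<gamma>) \<le> norm y\<^sub>0 / sqrt \<gamma>" if "\<gamma> > 0" for \<gamma>
  proof -
    have "(norm (e \<gamma>))\<^sup>2 \<le> (norm y\<^sub>0 / sqrt \<gamma>)\<^sup>2"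
      using ridge_residual_bound[OF Q(1) Q(4) eq[OF that]] that
      by (simp add: e_def power_divide field_simps)
    then show ?thesis
      by (rule power2_le_imp_le) (use that in simp)
  qed
  note tends_mult = bounded_linear.tendsto[OF matrix_vector_mul_bounded_linear]

  have "((\<lambda>\<gamma>. \<gamma> *\<^sub>R e \<gamma>) \<longlongrightarrow> 0) (at_right 0)"
  proof (rule Lim_null_comparison)
    \<comment> \<open>The bound on \<open>e\<close> grows like 1 / sqrt \<gamma> near 0, but the
      factor \<gamma> outweighs it.\<close>
    have "norm (\<gamma> *\<^sub>R e \<gamma>) \<le> sqrt \<gamma> * norm y\<^sub>0" if "\<gamma> > 0" for \<gamma>
      using mult_left_mono[OF e[OF that], of \<gamma>] that
      by (simp add: real_div_sqrt flip: times_divide_eq_left)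
    then show "\<forall>\<^sub>F \<gamma> in at_right 0. norm (\<gamma> *\<^sub>R e \<gamma>) \<le> sqrt \<gamma> * norm y\<^sub>0"
      by (auto simp: eventually_at_filter)
    have "((\<lambda>\<gamma>. sqrt \<gamma> * norm y\<^sub>0) \<longlongrightarrow> sqrt 0 * norm y\<^sub>0) (at_right 0)"
      by (intro tendsto_intros)
    then show "((\<lambda>\<gamma>. sqrt \<gamma> * norm y\<^sub>0) \<longlongrightarrow> 0) (at_right 0)"
      by simp
  qed
  from tends_mult[OF tends_mult[OF tendsto_diff[OF tendsto_const this]]]
  have "((\<lambda>\<gamma>. X' *v (N *v (transpose X\<^sub>0 *v y\<^sub>0 - \<gamma> *\<^sub>R e \<gamma>))) \<longlongrightarrow>
      X' *v (N *v (transpose X\<^sub>0 *v y\<^sub>0 - 0))) (at_right 0)" .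
  \<comment> \<open>Solving the penalised equation for \<open>w \<gamma>\<close> with the penalty
    moved to the right-hand side; \<open>N\<close> does not depend on \<gamma>.\<close>
  moreover have "X' *v (N *v (transpose X\<^sub>0 *v y\<^sub>0 - \<gamma> *\<^sub>R e \<gamma>)) = profile_predictor M (\<Sigma> \<gamma>) y\<^sub>0"
    if "\<gamma> > 0" for \<gamma>
    using w[OF that] by (simp add: e_def N flip: eq[OF that])
  then have "\<forall>\<^sub>F \<gamma> in at_right 0.
      X' *v (N *v (transpose X\<^sub>0 *v y\<^sub>0 - \<gamma> *\<^sub>R e \<gamma>)) = profile_predictor M (\<Sigma> \<gamma>) y\<^sub>0"
    by (auto simp: eventually_at_filter)
  ultimately have lim0: "((\<lambda>\<gamma>. profile_predictor M (\<Sigma> \<gamma>) y\<^sub>0) \<longlongrightarrow>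
      X' *v (N *v (transpose X\<^sub>0 *v y\<^sub>0))) (at_right 0)"
    by (simp add: tendsto_cong)

  have "(e \<longlongrightarrow> 0) at_top"
  proof (rule Lim_null_comparison)
    show "\<forall>\<^sub>F \<gamma> in at_top. norm (e \<gamma>) \<le> norm y\<^sub>0 / sqrt \<gamma>"
      using eventually_gt_at_top[of 0] by eventually_elim (rule e)
    show "((\<lambda>\<gamma>. norm y\<^sub>0 / sqrt \<gamma>) \<longlongrightarrow> 0) at_top"
      by (intro real_tendsto_divide_at_top[OF tendsto_const] sqrt_at_top)
  qed
  from tendsto_add[OF tends_mult[OF tends_mult[OF tends_mult[OF tendsto_diff[OF tendsto_const
            tends_mult[OF this]]]]] tends_mult[OF this]]
  have "((\<lambda>\<gamma>. M' *v (N\<^sub>A *v (transpose M\<^sub>0 *v (y\<^sub>0 - X\<^sub>0 *v e \<gamma>))) + X' *v e \<gamma>) \<longlongrightarrow>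
      M' *v (N\<^sub>A *v (transpose M\<^sub>0 *v (y\<^sub>0 - X\<^sub>0 *v 0))) + X' *v 0) at_top" .
  \<comment> \<open>The predictor is written through \<open>e \<gamma>\<close> alone, with
    \<gamma>-independent matrices. This avoids any bound on the rest of \<open>w \<gamma>\<close>:
    its category coefficients \<open>transpose A *v w \<gamma>\<close> are recovered by regression
    on \<open>M\<^sub>0\<close>.\<close>
  moreover have "M' *v (N\<^sub>A *v (transpose M\<^sub>0 *v (y\<^sub>0 - X\<^sub>0 *v e \<gamma>))) + X' *v e \<gamma> =
      profile_predictor M (\<Sigma> \<gamma>) y\<^sub>0" if "\<gamma> > 0" for \<gamma>
  proof -
    have Hw: "X\<^sub>0 *v w \<gamma> - X\<^sub>0 *v e \<gamma> = M\<^sub>0 *v (transpose A *v w \<gamma>)"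
      by (subst decomp[of "w \<gamma>", symmetric])
        (simp add: e_def M\<^sub>0 matrix_vector_right_distrib flip: matrix_vector_mul_assoc)
    have "transpose M\<^sub>0 *v y\<^sub>0 = transpose H *v (transpose X\<^sub>0 *v y\<^sub>0)"
      by (simp add: M\<^sub>0 matrix_transpose_mul matrix_vector_mul_assoc)
    \<comment> \<open>Applying \<open>transpose H\<close> to the penalised equation removes the
      penalty by \<open>HQ\<close>, whatever the size of \<gamma>.\<close>
    also have "\<dots> = transpose M\<^sub>0 *v (X\<^sub>0 *v w \<gamma>)"
      by (simp add: M\<^sub>0 matrix_transpose_mul matrix_vector_right_distrib matrix_vector_mult_scaleR
          matrix_vector_mul_assoc matrix_mul_assoc HQ flip: eq[OF that])
    finally have "transpose M\<^sub>0 *v (y\<^sub>0 - X\<^sub>0 *v e \<gamma>) =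
        transpose M\<^sub>0 *v (M\<^sub>0 *v (transpose A *v w \<gamma>))"
      by (simp add: matrix_vector_mult_diff_distrib flip: Hw)
    then have "M' *v (N\<^sub>A *v (transpose M\<^sub>0 *v (y\<^sub>0 - X\<^sub>0 *v e \<gamma>))) + X' *v e \<gamma> =
        X' *v (H *v (transpose A *v w \<gamma>) + Q *v w \<gamma>)"
      by (simp add: N\<^sub>A e_def M' matrix_vector_right_distrib flip: matrix_vector_mul_assoc)
    then show ?thesis
      by (simp add: decomp w that)
  qed
  then have "\<forall>\<^sub>F \<gamma> in at_top. M' *v (N\<^sub>A *v (transpose M\<^sub>0 *v (y\<^sub>0 - X\<^sub>0 *v e \<gamma>))) + X' *v e \<gamma> =
      profile_predictor M (\<Sigma> \<gamma>) y\<^sub>0"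
    by (rule eventually_mono[OF eventually_gt_at_top[of 0]])
  ultimately have "((\<lambda>\<gamma>. profile_predictor M (\<Sigma> \<gamma>) y\<^sub>0) \<longlongrightarrow>
      M' *v (N\<^sub>A *v (transpose M\<^sub>0 *v y\<^sub>0))) at_top"
    by (simp add: tendsto_cong)
  with lim0 show ?thesis
    by (simp add: N_def N\<^sub>A_def flip: matrix_vector_mul_assoc)
qed

end
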